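(* Let $(P,d)$, $X$, $Y$ be metric spaces, let $\omega\in Y$, let $F:P\times X\rightrightarrows Y$ be a set-valued mapping, and let $\mathcal R:P\rightrightarrows X$, $\mathcal R(p)=\{x\in X:\ \omega\in F(p,x)\}$, be the associated solution mapping. Let $\bar p\in P$ and $\bar x\in\mathcal R(\bar p)$. Suppose that: (i) $(P,d)$ is metrically complete; (ii) there exists $\delta_0>0$ such that $F(\cdot,x):P\rightrightarrows Y$ is Hausdorff u.s.c. on $\mathrm B(\bar p,\delta_0)$, for every $x\in \mathrm B(\bar x,\delta_0)$; (iii) $F(\bar p,\cdot):X\rightrightarrows Y$ is uniformly Lipschitz l.s.c. at $(\bar x,\omega)$; (iv) $\overline{|\nabla_p |[F]||}{}^{>}(\bar p)>0$. Then $\mathcal R$ is uniformly hemiregular at $(\bar p,\bar x)$ and $$\mathrm{u.hreg}(\mathcal R,(\bar p,\bar x))\le \frac{\mathrm{u.liplsc}(F(\bar p,\cdot),(\bar x,\omega))}{\overline{|\nabla_p |[F]||}{}^{>}(\bar p)}.$$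
   Context: Conventions. In a metric space, $\mathrm B(a,r)=\{q:\ d(q,a)\le r\}$ is the closed ball; $\mathrm{dist}(a,S)=\inf_{s\in S}d(a,s)$ with $\mathrm{dist}(a,\varnothing)=+\infty$; $\mathrm B(S,r)=\{q:\ \mathrm{dist}(q,S)\le r\}$. For a set-valued mapping $\Theta$, $\mathrm{grph}\,\Theta$ is its graph, $\mathrm{dom}\,\Theta$ the set of points where its value is nonempty, and $\Theta^{-1}(x)=\{p:\ x\in\Theta(p)\}$. All set-valued mappings considered are assumed to take closed values. A quotient with finite numerator and denominator $+\infty$ is read as $0$. Uniform hemiregularity. $\Theta:P\rightrightarrows X$ between metric spaces is uniformly hemiregular at $(\bar p,\bar x)\in\mathrm{grph}\,\Theta$ if there exist $\kappa>0$, $r>0$ such that $$\mathrm{dist}(\bar p,\Theta^{-1}(x))\le\kappa d(x,z)\quad\forall x\in \mathrm B(z,r),\ \forall z\in\Theta(\bar p)\cap \mathrm B(\bar x,r).$$ Its modulus $\mathrm{u.hreg}(\Theta,(\bar p,\bar x))$ is the infimum of all $\kappa>0$ for which there exists $r>0$ such that this holds. Uniform Lipschitz lower semicontinuity. $\Phi:X\rightrightarrows Y$ is uniformly Lipschitz l.s.c. at $(\bar x,\bar y)\in\mathrm{grph}\,\Phi$ if there exist $\delta>0$, $l>0$ such that $$\Phi(x)\cap \mathrm B\big(\bar y,\,l\,\mathrm{dist}(x,\Phi^{-1}(\bar y))\big)\ne\varnothing\quad\forall x\in \mathrm B(\bar x,\delta).$$ Its modulus $\mathrm{u.liplsc}(\Phi,(\bar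 x,\bar y))$ is the infimum of all $l>0$ for which there exists $\delta>0$ such that this holds. Hausdorff upper semicontinuity. $G:P\rightrightarrows Y$ is Hausdorff u.s.c. at $q\in\mathrm{dom}\,G$ if for every $\epsilon>0$ there is $\delta_\epsilon>0$ with $G(p)\subseteq \mathrm B(G(q),\epsilon)$ for all $p\in \mathrm B(q,\delta_\epsilon)$; it is Hausdorff u.s.c. on a set if it is so at each point of the set. Displacement and strict outer slope. $|[F]|:P\times X\to[0,+\infty]$ is $|[F]|(p,x)=\mathrm{dist}(\omega,F(p,x))$. The partial strong slope is $|\nabla_p|[F]||(p,x)=0$ if $p$ is a local minimizer of $|[F]|(\cdot,x)$, and $$|\nabla_p|[F]||(p,x)=\limsup_{q\to p}\frac{|[F]|(p,x)-|[F]|(q,x)}{d(q,p)}$$ otherwise. The strict outer slope (relative to the reference pair $(\bar p,\bar x)$) is $$\overline{|\nabla_p|[F]||}{}^{>}(\bar p)=\lim_{\epsilon\to0^+}\inf\{|\nabla_p|[F]||(p,x):\ p\in \mathrm B(\bar p,\epsilon),\ x\in \mathrm B(\bar x,\epsilon),\ |[F]|(\bar p,\bar x)<|[F]|(p,x)<|[F]|(\bar p,\bar x)+\epsilon\},$$ with the infimum over the empty set equal to $+\infty$. *)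

theory Defs
  imports "HOL-Analysis.Analysis"
begin

text \<open>Distances, slopes and moduli take values in the extended reals. The library function
  \<open>infdist\<close> cannot be used here, since it assigns to the empty set the distance 0 instead
  of \<open>\<infinity>\<close>.\<close>

definition dist_set :: "'a::metric_space \<Rightarrow> 'a set \<Rightarrow> ereal" where
  "dist_set a S = (INF s\<in>S. ereal (dist a s))"

definition enlarge :: "'a::metric_space set \<Rightarrow> real \<Rightarrow> 'a set" where
  "enlarge S r = {q. dist_set q S \<le> ereal r}"

definition grph :: "('a \<Rightarrow> 'b set) \<Rightarrow> ('a \<times> 'b) set" where
  "grph \<Theta> = {(p, x). x \<in> \<Theta> p}"

definition sv_dom :: "('a \<Rightarrow> 'b set) \<Rightarrow> 'a set" where
  "sv_dom \<Theta> = {p. \<Theta> p \<noteq> {}}"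

definition sv_inv :: "('a \<Rightarrow> 'b set) \<Rightarrow> 'b \<Rightarrow> 'a set" where
  "sv_inv \<Theta> x = {p. x \<in> \<Theta> p}"

definition u_hemireg_const ::
  "('p::metric_space \<Rightarrow> 'x::metric_space set) \<Rightarrow> 'p \<Rightarrow> 'x \<Rightarrow> real \<Rightarrow> bool" where
  "u_hemireg_const \<Theta> p0 x0 \<kappa> \<longleftrightarrow>
     (\<exists>r>0. \<forall>z \<in> \<Theta> p0 \<inter> cball x0 r. \<forall>x \<in> cball z r.
        dist_set p0 (sv_inv \<Theta> x) \<le> ereal (\<kappa> * dist x z))"

definition uniformly_hemiregular ::
  "('p::metric_space \<Rightarrow> 'x::metric_space set) \<Rightarrow> 'p \<Rightarrow> 'x \<Rightarrow> bool" where
  "uniformly_hemiregular \<Theta> p0 x0 \<longleftrightarrow>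
     (p0, x0) \<in> grph \<Theta> \<and> (\<exists>\<kappa>>0. u_hemireg_const \<Theta> p0 x0 \<kappa>)"

definition u_hreg ::
  "('p::metric_space \<Rightarrow> 'x::metric_space set) \<Rightarrow> 'p \<Rightarrow> 'x \<Rightarrow> ereal" where
  "u_hreg \<Theta> p0 x0 = Inf (ereal ` {\<kappa>. \<kappa> > 0 \<and> u_hemireg_const \<Theta> p0 x0 \<kappa>})"

text \<open>The ball around \<open>y0\<close> has an extended-real radius, hence is written out.\<close>

definition u_liplsc_const ::
  "('x::metric_space \<Rightarrow> 'y::metric_space set) \<Rightarrow> 'x \<Rightarrow> 'y \<Rightarrow> real \<Rightarrow> bool" where
  "u_liplsc_const \<Phi> x0 y0 l \<longleftrightarrow>
     (\<exists>\<delta>>0. \<forall>x \<in> cball x0 \<delta>.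
        \<Phi> x \<inter> {y. ereal (dist y y0) \<le> ereal l * dist_set x (sv_inv \<Phi> y0)} \<noteq> {})"

definition uniformly_Lipschitz_lsc ::
  "('x::metric_space \<Rightarrow> 'y::metric_space set) \<Rightarrow> 'x \<Rightarrow> 'y \<Rightarrow> bool" where
  "uniformly_Lipschitz_lsc \<Phi> x0 y0 \<longleftrightarrow>
     (x0, y0) \<in> grph \<Phi> \<and> (\<exists>l>0. u_liplsc_const \<Phi> x0 y0 l)"

definition u_liplsc ::
  "('x::metric_space \<Rightarrow> 'y::metric_space set) \<Rightarrow> 'x \<Rightarrow> 'y \<Rightarrow> ereal" where
  "u_liplsc \<Phi> x0 y0 = Inf (ereal ` {l. l > 0 \<and> u_liplsc_const \<Phi> x0 y0 l})"

definition hausdorff_usc_at ::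
  "('p::metric_space \<Rightarrow> 'y::metric_space set) \<Rightarrow> 'p \<Rightarrow> bool" where
  "hausdorff_usc_at G q \<longleftrightarrow>
     q \<in> sv_dom G \<and> (\<forall>\<epsilon>>0. \<exists>\<delta>>0. \<forall>p \<in> cball q \<delta>. G p \<subseteq> enlarge (G q) \<epsilon>)"

definition hausdorff_usc_on ::
  "'p::metric_space set \<Rightarrow> ('p \<Rightarrow> 'y::metric_space set) \<Rightarrow> bool" where
  "hausdorff_usc_on S G \<longleftrightarrow> (\<forall>q\<in>S. hausdorff_usc_at G q)"

definition solution_map :: "('p \<times> 'x \<Rightarrow> 'y set) \<Rightarrow> 'y \<Rightarrow> 'p \<Rightarrow> 'x set" where
  "solution_map F \<omega> p = {x. \<omega> \<in> F (p, x)}"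

definition displacement ::
  "('p \<times> 'x \<Rightarrow> 'y::metric_space set) \<Rightarrow> 'y \<Rightarrow> 'p \<times> 'x \<Rightarrow> ereal" where
  "displacement F \<omega> = (\<lambda>(p, x). dist_set \<omega> (F (p, x)))"

text \<open>The filter \<open>at p\<close> is punctured, so the quotient is never taken at \<open>q = p\<close>; an isolated
  point is a local minimizer. If \<open>f p = \<infinity>\<close> and \<open>p\<close> is not a local minimizer, the upper limit
  is \<open>\<infinity>\<close> irrespective of the library's value of \<open>\<infinity> - \<infinity>\<close>.\<close>

definition strong_slope :: "('p::metric_space \<Rightarrow> ereal) \<Rightarrow> 'p \<Rightarrow> ereal" where
  "strong_slope f p =
     (if \<forall>\<^sub>F q in nhds p. f p \<le> f q then 0
      else Limsup (at p) (\<lambda>q. (f p - f q) / ereal (dist q p)))"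

definition partial_strong_slope ::
  "('p::metric_space \<times> 'x \<Rightarrow> 'y::metric_space set) \<Rightarrow> 'y \<Rightarrow> 'p \<times> 'x \<Rightarrow> ereal" where
  "partial_strong_slope F \<omega> = (\<lambda>(p, x). strong_slope (\<lambda>q. displacement F \<omega> (q, x)) p)"

definition outer_slope_inf ::
  "('p::metric_space \<times> 'x::metric_space \<Rightarrow> 'y::metric_space set) \<Rightarrow> 'y \<Rightarrow> 'p \<Rightarrow> 'x
    \<Rightarrow> real \<Rightarrow> ereal" where
  "outer_slope_inf F \<omega> p0 x0 \<epsilon> =
     Inf {partial_strong_slope F \<omega> (p, x) | p x.
            p \<in> cball p0 \<epsilon> \<and> x \<in> cball x0 \<epsilon> \<and>
            displacement F \<omega> (p0, x0) < displacement F \<omega> (p, x) \<and>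
            displacement F \<omega> (p, x) < displacement F \<omega> (p0, x0) + ereal \<epsilon>}"

definition strict_outer_slope ::
  "('p::metric_space \<times> 'x::metric_space \<Rightarrow> 'y::metric_space set) \<Rightarrow> 'y \<Rightarrow> 'p \<Rightarrow> 'x
    \<Rightarrow> ereal" where
  "strict_outer_slope F \<omega> p0 x0 = Lim (at_right 0) (outer_slope_inf F \<omega> p0 x0)"

text \<open>The limit always exists, by monotonicity.\<close>

lemma outer_slope_inf_antimono:
  assumes "\<epsilon> \<le> \<epsilon>'"
  shows "outer_slope_inf F \<omega> p0 x0 \<epsilon>' \<le> outer_slope_inf F \<omega> p0 x0 \<epsilon>"
proof -
  have "displacement F \<omega> (p0, x0) + ereal \<epsilon> \<le> displacement F \<omega> (p0, x0) + ereal \<epsilon>'"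
    using assms by (intro add_left_mono) simp
  then show ?thesis
    unfolding outer_slope_inf_def using assms
    by (intro Inf_superset_mono) (fastforce intro: order_trans order.strict_trans2)
qed

lemma outer_slope_inf_tendsto:
  "(outer_slope_inf F \<omega> p0 x0 \<longlongrightarrow> strict_outer_slope F \<omega> p0 x0) (at_right 0)"
proof -
  let ?f = "outer_slope_inf F \<omega> p0 x0"
  let ?s = "SUP \<epsilon>\<in>{0<..}. ?f \<epsilon>"
  have "(?f \<longlongrightarrow> ?s) (at_right 0)"
  proof (rule order_tendstoI)
    fix a assume "a < ?s"
    then obtain e where e: "e > 0" "a < ?f e"
      by (auto simp: less_SUP_iff)
    show "\<forall>\<^sub>F x in at_right 0. a < ?f x"
      unfolding eventually_at_right_field
      using e outer_slope_inf_antimono[of _ e F \<omega> p0 x0]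
      by (intro exI[of _ e]) (auto intro: order.strict_trans2)
  next
    fix a assume a: "?s < a"
    show "\<forall>\<^sub>F x in at_right 0. ?f x < a"
      using eventually_at_right_less
    proof (rule eventually_mono)
      fix x :: real assume "0 < x"
      then have "?f x \<le> ?s" by (intro SUP_upper) simp
      then show "?f x < a" using a by (rule order.strict_trans1)
    qed
  qed
  then show ?thesis
    unfolding strict_outer_slope_def using tendsto_Lim trivial_limit_at_right_real by metis
qed

end

theory Submission
  imports Defs
begin

text \<open>The proof is a variational argument for the displacement
  \<open>\<phi>(p, x) = dist(\<omega>, F(p, x))\<close>, which vanishes exactly where \<open>x\<close> solves the inclusion at \<open>p\<close>,
  because \<open>F\<close> has closed values.

  Let \<open>0 < c\<close> be smaller than the strict outer slope and let \<open>l\<close> be a constant for the uniform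
  Lipschitz lower semicontinuity of \<open>F(p0, \<cdot>)\<close>. For \<open>z\<close> near \<open>x0\<close> solving the inclusion at \<open>p0\<close>,
  and \<open>x\<close> near \<open>z\<close>, lower semicontinuity gives \<open>\<phi>(p0, x) \<le> l d(x, z)\<close>. Hausdorff upper
  semicontinuity makes \<open>\<phi>(\<cdot>, x)\<close> finite and lower semicontinuous on a ball around \<open>p0\<close>, which is
  complete. Ekeland's principle (\<open>ekeland\<close>) with slope \<open>c\<close>, started at \<open>p0\<close>, yields a point \<open>p\<close>
  with \<open>c d(p, p0) \<le> \<phi>(p0, x)\<close> at which \<open>\<phi>(\<cdot>, x)\<close> decreases at rate at most \<open>c\<close>, so its strong slope
  is at most \<open>c\<close> (\<open>strong_slope_le\<close>). As all slopes at nearby points of small positive displacement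
  exceed \<open>c\<close>, the displacement at \<open>p\<close> is zero (\<open>solution_near_of_slope\<close>). Thus \<open>p\<close> solves the
  inclusion for \<open>x\<close> at distance at most \<open>(l / c) d(x, z)\<close> from \<open>p0\<close>, that is, \<open>l / c\<close> is a constant
  of uniform hemiregularity. Optimizing over \<open>l\<close> and \<open>c\<close> gives the estimate of the moduli.\<close>

section \<open>Ekeland's variational principle\<close>

lemma ekeland:
  fixes f :: "'a::metric_space \<Rightarrow> real"
  assumes S: "complete S" and a: "a \<in> S" and c: "c > 0"
    and lower: "\<And>q. q \<in> S \<Longrightarrow> m \<le> f q"
    and lsc: "\<And>q y. q \<in> S \<Longrightarrow> y < f q \<Longrightarrow> \<forall>\<^sub>F p in at q within S. y < f p"
  shows "\<exists>p\<in>S. f p + c * dist p a \<le> f a \<and> (\<forall>q\<in>S. q \<noteq> p \<longrightarrow> f p < f q + c * dist q p)"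
proof -
  \<comment> \<open>\<open>T p\<close> collects the points that a descent from \<open>p\<close> at rate at least \<open>c\<close> may reach. These sets
    shrink along a sequence whose next term nearly minimizes \<open>f\<close> on the current set, and for its
    limit \<open>p\<close> the set \<open>T p\<close> is a singleton.\<close>
  define T where "T p = {q \<in> S. f q + c * dist q p \<le> f p}" for p
  have T_sub: "T q \<subseteq> T p" if "q \<in> T p" for p q
  proof
    fix r assume r: "r \<in> T q"
    have "c * dist r p \<le> c * dist r q + c * dist q p"
      using c dist_triangle[of r p q] by (simp flip: distrib_left)
    then show "r \<in> T p" using r that by (auto simp: T_def)
  qed
  have T_self: "p \<in> T p" if "p \<in> S" for p using that by (auto simp: T_def)
  have step: "\<exists>q. q \<in> T p \<and> (\<forall>r\<in>T p. f q \<le> f r + (1/2)^n)" if "p \<in> S" for p and n :: nat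
  proof -
    have ne: "f ` T p \<noteq> {}" using T_self[OF that] by auto
    have bdd: "bdd_below (f ` T p)" by (rule bdd_belowI[of _ m]) (auto simp: T_def lower)
    have "Inf (f ` T p) < Inf (f ` T p) + (1/2)^n" by simp
    then obtain q where q: "q \<in> T p" "f q < Inf (f ` T p) + (1/2)^n"
      using cInf_lessD[OF ne] by (metis imageE)
    moreover have "Inf (f ` T p) \<le> f r" if "r \<in> T p" for r
      using that bdd by (intro cInf_lower) auto
    ultimately show ?thesis by (smt (verit))
  qed
  obtain u where u0: "u 0 = a" and uS: "\<And>n. u n \<in> S"
    and u: "\<And>n. u (Suc n) \<in> T (u n) \<and> (\<forall>r\<in>T (u n). f (u (Suc n)) \<le> f r + (1/2)^n)"
  proof -
    have "\<exists>u. \<forall>n. (u n \<in> S \<and> (n = 0 \<longrightarrow> u n = a)) \<and>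
        (u (Suc n) \<in> T (u n) \<and> (\<forall>r\<in>T (u n). f (u (Suc n)) \<le> f r + (1/2)^n))"
      using a step by (intro dependent_nat_choice) (fastforce simp: T_def)+
    then show ?thesis using that by blast
  qed
  have uT: "u m \<in> T (u n)" if "n \<le> m" for m n
    using that
  proof (induction m rule: dec_induct)
    case base show ?case by (rule T_self[OF uS])
  next
    case (step m) then show ?case using T_sub u by blast
  qed
  have near: "dist r (u (Suc n)) \<le> (1/2)^n / c" if "r \<in> T (u (Suc n))" for r n
  proof -
    have "r \<in> T (u n)" using that T_sub u by blast
    then have "f (u (Suc n)) \<le> f r + (1/2)^n" using u by blast
    then have "c * dist r (u (Suc n)) \<le> (1/2)^n" using that by (auto simp: T_def)
    then show ?thesis using c by (simp add: field_simps)
  qed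
  have rad: "(\<lambda>n. (1/2)^n / c) \<longlonglongrightarrow> 0"
    by (intro tendsto_divide_zero LIMSEQ_power_zero) simp
  have "Cauchy u"
  proof (rule metric_CauchyI)
    fix e :: real assume "e > 0"
    then obtain n where n: "(1/2)^n / c < e / 2"
      using order_tendstoD(2)[OF rad, of "e/2"] by (auto simp: eventually_sequentially)
    have "dist (u k) (u (Suc n)) < e / 2" if "k \<ge> Suc n" for k
      using near[OF uT[OF that]] n by linarith
    then show "\<exists>M. \<forall>k\<ge>M. \<forall>l\<ge>M. dist (u k) (u l) < e"
      using dist_triangle_half_l by (metis dist_commute)
  qed
  then obtain p where p: "p \<in> S" "u \<longlonglongrightarrow> p"
    using S uS unfolding complete_def by blast
  have pT: "p \<in> T (u n)" for n
  proof (rule ccontr)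
    assume "p \<notin> T (u n)"
    then have "f (u n) - c * dist p (u n) < f p" using p by (auto simp: T_def)
    then obtain y where y: "f (u n) - c * dist p (u n) < y" "y < f p" using dense by blast
    have "\<forall>\<^sub>F k in sequentially. y < f (u k)"
    proof -
      obtain d where d: "d > 0" "\<And>q. q \<in> S \<Longrightarrow> q \<noteq> p \<Longrightarrow> dist q p < d \<Longrightarrow> y < f q"
        using lsc[OF p(1) y(2)] by (auto simp: eventually_at)
      have "\<forall>\<^sub>F k in sequentially. dist (u k) p < d" using p(2) d(1) by (rule tendstoD)
      then show ?thesis by eventually_elim (use d(2) uS y in blast)
    qed
    moreover have "\<forall>\<^sub>F k in sequentially. f (u k) \<le> f (u n) - c * dist (u k) (u n)"
      using eventually_ge_at_top[of n] by eventually_elim (use uT in \<open>simp add: T_def algebra_simps\<close>)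
    ultimately have "\<forall>\<^sub>F k in sequentially. y \<le> f (u n) - c * dist (u k) (u n)"
      by eventually_elim simp
    moreover have "(\<lambda>k. f (u n) - c * dist (u k) (u n)) \<longlonglongrightarrow> f (u n) - c * dist p (u n)"
      by (intro tendsto_intros p)
    ultimately have "y \<le> f (u n) - c * dist p (u n)"
      by (intro tendsto_lowerbound) auto
    then show False using y by simp
  qed
  have "q = p" if "q \<in> T p" for q
  proof -
    have "dist q (u (Suc n)) \<le> (1/2)^n / c" for n using near that T_sub pT by blast
    then have "(\<lambda>n. u (Suc n)) \<longlonglongrightarrow> q"
      by (intro metric_tendsto_imp_tendsto[OF rad]) (simp add: dist_commute c less_imp_le)
    moreover have "(\<lambda>n. u (Suc n)) \<longlonglongrightarrow> p" using p(2) by (rule LIMSEQ_Suc)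
    ultimately show "q = p" by (rule LIMSEQ_unique)
  qed
  then show ?thesis using p(1) pT[of 0] by (force simp: T_def u0 not_le)
qed

section \<open>Distances to sets and the strong slope\<close>

lemma dist_set_le: "s \<in> S \<Longrightarrow> dist_set a S \<le> ereal (dist a s)"
  unfolding dist_set_def by (rule INF_lower)

lemma dist_set_nonneg: "0 \<le> dist_set a S"
  unfolding dist_set_def by (rule INF_greatest) simp

lemma dist_set_finite: "S \<noteq> {} \<Longrightarrow> \<bar>dist_set a S\<bar> \<noteq> \<infinity>"
  using dist_set_le[of _ S a] dist_set_nonneg[of a S] by fastforce

lemma dist_set_eq_0_imp_mem:
  assumes "closed S" "dist_set a S = 0"
  shows "a \<in> S"
proof -
  have "\<exists>s\<in>S. dist s a < e" if "e > 0" for e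
  proof -
    have "(INF s\<in>S. ereal (dist a s)) < ereal e" using assms(2) that by (simp add: dist_set_def)
    then show ?thesis by (auto simp: INF_less_iff dist_commute)
  qed
  then show ?thesis using closed_approachable[OF assms(1)] by blast
qed

lemma dist_set_le_add_of_subset_enlarge:
  assumes "A \<subseteq> enlarge B e"
  shows "dist_set a B \<le> dist_set a A + ereal e"
proof -
  have "dist_set a B \<le> ereal (dist a y + e)" if y: "y \<in> A" for y
  proof (rule ereal_le_epsilon2)
    fix d :: real assume "d > 0"
    have "dist_set y B < ereal (e + d)"
      using assms y \<open>d > 0\<close> by (auto simp: enlarge_def intro: le_less_trans[of _ "ereal e"])
    then obtain b where b: "b \<in> B" "dist y b < e + d"
      by (auto simp: dist_set_def INF_less_iff)
    have "dist_set a B \<le> ereal (dist a b)" using b(1) by (rule dist_set_le)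
    also have "\<dots> \<le> ereal (dist a y + e) + ereal d"
      using b(2) dist_triangle[of a b y] by simp
    finally show "dist_set a B \<le> ereal (dist a y + e) + ereal d" .
  qed
  then have "dist_set a B - ereal e \<le> dist_set a A"
    unfolding dist_set_def[of a A]
    by (intro INF_greatest) (simp add: ereal_minus_le add.commute)
  then show ?thesis by (simp add: ereal_minus_le add.commute)
qed

lemma strong_slope_le:
  assumes c: "c \<ge> 0" and fin: "\<bar>f p\<bar> \<noteq> \<infinity>"
    and ev: "\<forall>\<^sub>F q in at p. f p \<le> f q + ereal (c * dist q p)"
  shows "strong_slope f p \<le> ereal c"
proof -
  have "\<forall>\<^sub>F q in at p. (f p - f q) / ereal (dist q p) \<le> ereal c"
    using ev eventually_neq_at_within[of p p UNIV]
  proof eventually_elim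
    case (elim q)
    then show ?case
      using fin by (cases "f p"; cases "f q") (auto simp: field_simps)
  qed
  then show ?thesis
    using c by (auto simp: strong_slope_def intro: Limsup_bounded)
qed

section \<open>Solvability from a lower bound on slopes\<close>

text \<open>A decrease principle: if, at the points of the ball whose displacement is positive and not
  above the one at \<open>p0\<close>, the slope exceeds \<open>c\<close>, then a zero is found within the distance in which
  a descent at rate \<open>c\<close> exhausts the displacement at \<open>p0\<close>. The assumption on this displacement
  keeps the descent inside the ball.\<close>

lemma solution_near_of_slope:
  fixes G :: "'p::metric_space \<Rightarrow> 'y::metric_space set"
  assumes compl: "complete (UNIV :: 'p set)" and closed: "\<And>p. closed (G p)"
    and usc: "hausdorff_usc_on (cball p0 \<rho>) G" and c: "c > 0"
    and init: "dist_set \<omega> (G p0) < ereal (c * \<rho>)"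
    and slope: "\<And>p. p \<in> cball p0 \<rho> \<Longrightarrow> 0 < dist_set \<omega> (G p) \<Longrightarrow>
      dist_set \<omega> (G p) \<le> dist_set \<omega> (G p0) \<Longrightarrow> ereal c < strong_slope (\<lambda>q. dist_set \<omega> (G q)) p"
  shows "\<exists>p. \<omega> \<in> G p \<and> ereal (c * dist p p0) \<le> dist_set \<omega> (G p0)"
proof -
  define \<phi> where "\<phi> p = dist_set \<omega> (G p)" for p
  define f where "f p = real_of_ereal (\<phi> p)" for p
  let ?B = "cball p0 \<rho>"
  have "0 < ereal (c * \<rho>)" using init dist_set_nonneg by (rule le_less_trans[rotated])
  then have \<rho>: "\<rho> > 0" using c by (simp add: zero_less_mult_iff)
  have fin: "\<phi> p = ereal (f p)" if "p \<in> ?B" for p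
    using usc that dist_set_finite[of "G p" \<omega>]
    by (auto simp: hausdorff_usc_on_def hausdorff_usc_at_def sv_dom_def f_def \<phi>_def ereal_real)
  have f_nonneg: "0 \<le> f p" for p
    by (simp add: f_def \<phi>_def real_of_ereal_pos dist_set_nonneg)
  have lsc: "\<forall>\<^sub>F p in at q within ?B. y < f p" if q: "q \<in> ?B" and y: "y < f q" for q y
  proof -
    have "(f q - y) / 2 > 0" using y by simp
    then obtain \<delta> where \<delta>: "\<delta> > 0" "\<And>p. p \<in> cball q \<delta> \<Longrightarrow> G p \<subseteq> enlarge (G q) ((f q - y) / 2)"
      using usc q unfolding hausdorff_usc_on_def hausdorff_usc_at_def by meson
    have "y < f p" if p: "p \<in> ?B" "dist p q < \<delta>" for p
    proof -
      have "\<phi> q \<le> \<phi> p + ereal ((f q - y) / 2)"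
        unfolding \<phi>_def using p(2)
        by (intro dist_set_le_add_of_subset_enlarge \<delta>(2)) (simp add: dist_commute)
      then have "f q \<le> f p + (f q - y) / 2" using fin[OF q] fin[OF p(1)] by simp
      then show ?thesis using y by (simp add: field_simps)
    qed
    then show ?thesis using \<delta>(1) by (auto simp: eventually_at)
  qed
  have p0: "p0 \<in> ?B" using \<rho> by simp
  have "complete ?B" using complete_Int_closed[OF compl, of ?B] by simp
  from ekeland[OF this p0 c f_nonneg lsc] obtain p where p: "p \<in> ?B"
      and pa: "f p + c * dist p p0 \<le> f p0"
      and pmin: "\<And>q. q \<in> ?B \<Longrightarrow> q \<noteq> p \<Longrightarrow> f p < f q + c * dist q p"
    by blast
  have cd: "c * dist p p0 \<le> f p0" using pa f_nonneg[of p] by linarith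
  have "f p0 < c * \<rho>" using init fin[OF p0] by (simp add: \<phi>_def)
  with cd have "c * dist p p0 < c * \<rho>" by linarith
  then have p_int: "p \<in> ball p0 \<rho>" using c by (simp add: dist_commute)
  have "strong_slope \<phi> p \<le> ereal c"
  proof (rule strong_slope_le)
    \<comment> \<open>\<open>p\<close> is interior to the ball, so the minimality on the ball is a local condition at \<open>p\<close>.\<close>
    have "\<forall>\<^sub>F q in at p. q \<in> ball p0 \<rho>"
      using p_int eventually_nhds_in_open[of "ball p0 \<rho>" p]
      by (auto simp: eventually_at_filter elim: eventually_mono)
    then show "\<forall>\<^sub>F q in at p. \<phi> p \<le> \<phi> q + ereal (c * dist q p)"
      using eventually_neq_at_within[of p p UNIV]
    proof eventually_elim
      case (elim q)
      then have "q \<in> ?B" by simp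
      then show ?case using pmin[of q] elim fin[of q] fin[OF p] by simp
    qed
  qed (use c fin[OF p] in auto)
  moreover have "\<phi> p \<le> \<phi> p0"
  proof -
    have "0 \<le> c * dist p p0" using c by simp
    then show ?thesis using pa fin[OF p] fin[OF p0] by simp
  qed
  ultimately have "\<not> 0 < \<phi> p"
    using slope[OF p] by (fold \<phi>_def) (auto simp: not_less[symmetric])
  then have "\<phi> p = 0" using dist_set_nonneg[of \<omega> "G p"] by (simp add: \<phi>_def)
  then have "\<omega> \<in> G p" unfolding \<phi>_def by (rule dist_set_eq_0_imp_mem[OF closed])
  then show ?thesis using cd fin[OF p0] by (auto simp: \<phi>_def)
qed

section \<open>Uniform hemiregularity of the solution map\<close>

lemma u_hemireg_const_solution_map:
  fixes F :: "'p::metric_space \<times> 'x::metric_space \<Rightarrow> 'y::metric_space set"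
  assumes closed: "\<And>p x. closed (F (p, x))"
    and ref: "x0 \<in> solution_map F \<omega> p0"
    and compl: "complete (UNIV :: 'p set)"
    and usc: "\<exists>\<delta>0>0. \<forall>x \<in> cball x0 \<delta>0. hausdorff_usc_on (cball p0 \<delta>0) (\<lambda>p. F (p, x))"
    and l: "l > 0" "u_liplsc_const (\<lambda>x. F (p0, x)) x0 \<omega> l"
    and c: "c > 0" "ereal c < strict_outer_slope F \<omega> p0 x0"
  shows "u_hemireg_const (solution_map F \<omega>) p0 x0 (l / c)"
proof -
  obtain \<delta>0 where \<delta>0: "\<delta>0 > 0"
    "\<And>x. x \<in> cball x0 \<delta>0 \<Longrightarrow> hausdorff_usc_on (cball p0 \<delta>0) (\<lambda>p. F (p, x))"
    using usc by blast
  obtain \<delta> where \<delta>: "\<delta> > 0" "\<And>x. x \<in> cball x0 \<delta> \<Longrightarrow> F (p0, x) \<inter>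
      {y. ereal (dist y \<omega>) \<le> ereal l * dist_set x (sv_inv (\<lambda>x. F (p0, x)) \<omega>)} \<noteq> {}"
    using l(2) unfolding u_liplsc_const_def by blast
  have "dist_set \<omega> (F (p0, x0)) \<le> 0"
    using ref dist_set_le[of \<omega> "F (p0, x0)" \<omega>] by (simp add: solution_map_def flip: zero_ereal_def)
  then have disp0: "displacement F \<omega> (p0, x0) = 0"
    by (simp add: displacement_def antisym[OF _ dist_set_nonneg])
  obtain \<epsilon> where \<epsilon>: "\<epsilon> > 0" "ereal c < outer_slope_inf F \<omega> p0 x0 \<epsilon>"
  proof -
    have "\<forall>\<^sub>F e in at_right 0. ereal c < outer_slope_inf F \<omega> p0 x0 e"
      using outer_slope_inf_tendsto c(2) by (rule order_tendstoD)
    then have "\<forall>\<^sub>F e in at_right 0. 0 < e \<and> ereal c < outer_slope_inf F \<omega> p0 x0 e"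
      using eventually_at_right_less[of 0] by eventually_elim simp
    then show ?thesis using that eventually_happens' trivial_limit_at_right_real by blast
  qed
  have slope: "ereal c < strong_slope (\<lambda>q. dist_set \<omega> (F (q, x))) p"
    if "p \<in> cball p0 \<epsilon>" "x \<in> cball x0 \<epsilon>" "0 < dist_set \<omega> (F (p, x))"
       "dist_set \<omega> (F (p, x)) < ereal \<epsilon>" for p x
  proof -
    have "outer_slope_inf F \<omega> p0 x0 \<epsilon> \<le> partial_strong_slope F \<omega> (p, x)"
      unfolding outer_slope_inf_def disp0 using that
      by (intro Inf_lower) (auto simp: displacement_def)
    then show ?thesis using \<epsilon>(2) by (simp add: partial_strong_slope_def displacement_def)
  qed
  define \<rho> where "\<rho> = min \<delta>0 \<epsilon>"
  have \<rho>: "\<rho> > 0" using \<delta>0 \<epsilon> by (simp add: \<rho>_def)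
  \<comment> \<open>\<open>2 r\<close> bounds the distance of \<open>x\<close> from \<open>x0\<close>, and \<open>l r\<close> the displacement at \<open>(p0, x)\<close>.\<close>
  have "\<forall>\<^sub>F r in at_right 0. 0 < r \<and> 2 * r < min \<rho> \<delta> \<and> l * r < min \<epsilon> (c * \<rho>)"
  proof (intro eventually_conj eventually_at_right_less)
    have "((\<lambda>r. 2 * r) \<longlongrightarrow> 2 * 0) (at_right (0::real))" by (intro tendsto_intros)
    then show "\<forall>\<^sub>F r in at_right 0. 2 * r < min \<rho> \<delta>"
      by (rule order_tendstoD) (use \<rho> \<delta> in simp)
    have "((\<lambda>r. l * r) \<longlongrightarrow> l * 0) (at_right 0)" by (intro tendsto_intros)
    then show "\<forall>\<^sub>F r in at_right 0. l * r < min \<epsilon> (c * \<rho>)"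
      by (rule order_tendstoD) (use \<rho> \<epsilon> c in simp)
  qed
  then obtain r where r: "r > 0" "2 * r < min \<rho> \<delta>" "l * r < min \<epsilon> (c * \<rho>)"
    using eventually_happens' trivial_limit_at_right_real by blast
  have "dist_set p0 (sv_inv (solution_map F \<omega>) x) \<le> ereal (l / c * dist x z)"
    if z: "z \<in> solution_map F \<omega> p0 \<inter> cball x0 r" and x: "x \<in> cball z r" for z x
  proof -
    have "dist x0 x \<le> 2 * r" using x z dist_triangle[of x0 x z] by auto
    then have x_near: "x \<in> cball x0 \<delta>" "x \<in> cball x0 \<delta>0" "x \<in> cball x0 \<epsilon>"
      using r(2) by (auto simp: \<rho>_def)
    obtain y where y: "y \<in> F (p0, x)"
        "ereal (dist y \<omega>) \<le> ereal l * dist_set x (sv_inv (\<lambda>x. F (p0, x)) \<omega>)"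
      using \<delta>(2)[OF x_near(1)] by blast
    have "dist_set \<omega> (F (p0, x)) \<le> ereal (dist y \<omega>)"
      using dist_set_le[OF y(1)] by (simp add: dist_commute)
    also note y(2)
    also have "ereal l * dist_set x (sv_inv (\<lambda>x. F (p0, x)) \<omega>) \<le> ereal l * ereal (dist x z)"
      using z l(1)
      by (intro ereal_mult_left_mono dist_set_le) (auto simp: sv_inv_def solution_map_def)
    finally have init: "dist_set \<omega> (F (p0, x)) \<le> ereal (l * dist x z)" by simp
    have "l * dist x z \<le> l * r" using x l(1) by (simp add: dist_commute)
    with init have init_r: "dist_set \<omega> (F (p0, x)) \<le> ereal (l * r)"
      by (auto intro: order_trans)
    have "\<exists>p. \<omega> \<in> F (p, x) \<and> ereal (c * dist p p0) \<le> dist_set \<omega> (F (p0, x))"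
    proof (rule solution_near_of_slope[OF compl closed _ c(1)])
      show "hausdorff_usc_on (cball p0 \<rho>) (\<lambda>p. F (p, x))"
        using \<delta>0(2)[OF x_near(2)] by (auto simp: hausdorff_usc_on_def \<rho>_def)
      show "dist_set \<omega> (F (p0, x)) < ereal (c * \<rho>)"
        using init_r r(3) by (auto intro: le_less_trans)
    next
      fix p assume "p \<in> cball p0 \<rho>" "0 < dist_set \<omega> (F (p, x))"
        and le: "dist_set \<omega> (F (p, x)) \<le> dist_set \<omega> (F (p0, x))"
      moreover have "dist_set \<omega> (F (p, x)) < ereal \<epsilon>"
        using order_trans[OF le init_r] r(3) by (auto intro: le_less_trans)
      ultimately show "ereal c < strong_slope (\<lambda>q. dist_set \<omega> (F (q, x))) p"
        using x_near(3) by (intro slope) (auto simp: \<rho>_def)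
    qed
    then obtain p where p: "\<omega> \<in> F (p, x)" "ereal (c * dist p p0) \<le> dist_set \<omega> (F (p0, x))"
      by blast
    have "c * dist p p0 \<le> l * dist x z" using order_trans[OF p(2) init] by simp
    then have "dist p0 p \<le> l / c * dist x z" using c(1) by (simp add: field_simps dist_commute)
    moreover have "dist_set p0 (sv_inv (solution_map F \<omega>) x) \<le> ereal (dist p0 p)"
      using p(1) by (intro dist_set_le) (simp add: sv_inv_def solution_map_def)
    ultimately show ?thesis by (meson ereal_less_eq(3) order_trans)
  qed
  then show ?thesis unfolding u_hemireg_const_def using r(1) by blast
qed

text \<open>The passage to the optimal constants. The value \<open>s = \<infinity>\<close>, for which the quotient is \<open>0\<close>,
  is included.\<close>

lemma le_divide_of_forall_less:
  fixes h L s :: ereal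
  assumes h: "0 \<le> h" and L: "0 \<le> L" "L \<noteq> \<infinity>" and s: "0 < s"
    and le: "\<And>c. 0 < c \<Longrightarrow> ereal c < s \<Longrightarrow> h \<le> L / ereal c"
  shows "h \<le> L / s"
proof -
  obtain L' where L': "L = ereal L'" "0 \<le> L'" using L by (cases L) auto
  obtain c0 where "0 < c0" "ereal c0 < s" using ereal_dense2[OF s] by auto
  from le[OF this] \<open>0 < c0\<close> h L' obtain h' where h': "h = ereal h'" "0 \<le> h'"
    by (cases h) auto
  show ?thesis
  proof (cases "h' = 0")
    case True
    have "0 \<le> L / s" using L s by simp
    then show ?thesis using True h' by (simp flip: zero_ereal_def)
  next
    case False
    with h' have pos: "h' > 0" by simp
    have "s \<le> ereal (L' / h')"
    proof (rule ccontr)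
      assume "\<not> s \<le> ereal (L' / h')"
      then obtain c where c: "L' / h' < c" "ereal c < s"
        using ereal_dense2[of "ereal (L' / h')" s] by (auto simp: not_le)
      have "0 < c" using c(1) L'(2) pos by (meson divide_nonneg_pos le_less_trans)
      then have "h' \<le> L' / c" using le[OF _ c(2)] h' L' by simp
      then show False using c(1) \<open>0 < c\<close> pos by (simp add: field_simps)
    qed
    then show ?thesis using s pos h' L' by (cases s) (auto simp: field_simps)
  qed
qed

theorem theorem4p3:
  fixes F :: "'p::metric_space \<times> 'x::metric_space \<Rightarrow> 'y::metric_space set"
    and \<omega> :: 'y and p0 :: 'p and x0 :: 'x
  assumes closed_values: "\<And>p x. closed (F (p, x))"
    and ref: "x0 \<in> solution_map F \<omega> p0"
    and compl: "complete (UNIV :: 'p set)"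
    and usc: "\<exists>\<delta>0>0. \<forall>x \<in> cball x0 \<delta>0. hausdorff_usc_on (cball p0 \<delta>0) (\<lambda>p. F (p, x))"
    and lsc: "uniformly_Lipschitz_lsc (\<lambda>x. F (p0, x)) x0 \<omega>"
    and slope: "strict_outer_slope F \<omega> p0 x0 > 0"
  shows "uniformly_hemiregular (solution_map F \<omega>) p0 x0 \<and>
         u_hreg (solution_map F \<omega>) p0 x0
           \<le> u_liplsc (\<lambda>x. F (p0, x)) x0 \<omega> / strict_outer_slope F \<omega> p0 x0"
proof
  let ?R = "solution_map F \<omega>" and ?s = "strict_outer_slope F \<omega> p0 x0"
  let ?\<Phi> = "\<lambda>x. F (p0, x)"
  have const: "u_hemireg_const ?R p0 x0 (l / c)"
    if "l > 0" "u_liplsc_const ?\<Phi> x0 \<omega> l" "c > 0" "ereal c < ?s" for l c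
    by (rule u_hemireg_const_solution_map[OF closed_values ref compl usc that])
  obtain l0 where l0: "l0 > 0" "u_liplsc_const ?\<Phi> x0 \<omega> l0"
    using lsc by (auto simp: uniformly_Lipschitz_lsc_def)
  obtain c0 where c0: "c0 > 0" "ereal c0 < ?s" using ereal_dense2[OF slope] by auto
  have "l0 / c0 > 0" using l0(1) c0(1) by simp
  then show "uniformly_hemiregular ?R p0 x0"
    using const[OF l0 c0] ref by (auto simp: uniformly_hemiregular_def grph_def)
  show "u_hreg ?R p0 x0 \<le> u_liplsc ?\<Phi> x0 \<omega> / ?s"
  proof (rule le_divide_of_forall_less)
    show "0 \<le> u_hreg ?R p0 x0" unfolding u_hreg_def by (rule Inf_greatest) auto
    show "0 \<le> u_liplsc ?\<Phi> x0 \<omega>" unfolding u_liplsc_def by (rule Inf_greatest) auto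
    have "u_liplsc ?\<Phi> x0 \<omega> \<le> ereal l0"
      unfolding u_liplsc_def using l0 by (intro Inf_lower) auto
    then show "u_liplsc ?\<Phi> x0 \<omega> \<noteq> \<infinity>" by auto
    show "0 < ?s" by (rule slope)
    fix c assume c: "0 < c" "ereal c < ?s"
    have "ereal c * u_hreg ?R p0 x0 \<le> u_liplsc ?\<Phi> x0 \<omega>"
      unfolding u_liplsc_def
    proof (rule Inf_greatest, clarify)
      fix l assume l: "l > 0" "u_liplsc_const ?\<Phi> x0 \<omega> l"
      have "u_hreg ?R p0 x0 \<le> ereal (l / c)"
        unfolding u_hreg_def using const[OF l c] l(1) c(1) by (intro Inf_lower) auto
      then have "ereal c * u_hreg ?R p0 x0 \<le> ereal c * ereal (l / c)"
        using c(1) by (intro ereal_mult_left_mono) auto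
      then show "ereal c * u_hreg ?R p0 x0 \<le> ereal l" using c(1) by simp
    qed
    then show "u_hreg ?R p0 x0 \<le> u_liplsc ?\<Phi> x0 \<omega> / ereal c"
      using c(1) by (simp add: ereal_le_divide_pos)
  qed
qed

end
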